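(* Let $G$ be a finite abelian group. Then $\mathcal{G}_e(G)$ has a cone vertex if and only if $G$ has a cyclic Sylow $p$-subgroup for some prime $p$ dividing $|G|$.
   Context: For a group $G$, the enhanced power graph $\mathcal{G}_e(G)$ is the simple undirected graph with vertex set $G$ in which two distinct vertices $x,y$ are adjacent if there exists $z\in G$ with $x=z^m$ and $y=z^n$ for some $m,n\in\mathbb{N}$. A cone vertex of $\mathcal{G}_e(G)$ is a vertex other than the identity element that is adjacent to every other vertex. *)

theory Defs
  imports
    "HOL-Algebra.Algebra"
    "Graph_Theory.Pair_Digraph"
begin

text \<open>
  As in Graph_Theory, an undirected graph is a symmetric digraph without loops or parallel arcs:
  an edge between \<open>x\<close> and \<open>y\<close> is the pair of arcs \<open>(x, y)\<close> and \<open>(y, x)\<close>.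
  The exponents include 0, so in any group the identity is adjacent to every other element.
\<close>

definition enhanced_power_graph :: "('a, 'b) monoid_scheme \<Rightarrow> 'a pair_pre_digraph" where
  "enhanced_power_graph G =
    \<lparr> pverts = carrier G,
      parcs = {(x, y). x \<in> carrier G \<and> y \<in> carrier G \<and> x \<noteq> y \<and>
        (\<exists>z \<in> carrier G. \<exists>(m :: nat) (n :: nat). x = z [^]\<^bsub>G\<^esub> m \<and> y = z [^]\<^bsub>G\<^esub> n)} \<rparr>"

lemma pair_graph_enhanced_power_graph:
  fixes G :: "('a, 'b) monoid_scheme"
  assumes "finite (carrier G)"
  shows "pair_graph (enhanced_power_graph G)"
proof
  let ?E = "enhanced_power_graph G"
  have "parcs ?E \<subseteq> carrier G \<times> carrier G"
    by (auto simp: enhanced_power_graph_def)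
  with assms show "finite (parcs ?E)"
    by (meson finite_SigmaI finite_subset)
  show "symmetric ?E"
    by (auto simp: symmetric_def sym_def enhanced_power_graph_def)
qed (use assms in \<open>auto simp: enhanced_power_graph_def\<close>)

definition cone_vertex :: "('a, 'b) monoid_scheme \<Rightarrow> 'a \<Rightarrow> bool" where
  "cone_vertex G x \<longleftrightarrow>
    x \<in> pverts (enhanced_power_graph G) \<and> x \<noteq> \<one>\<^bsub>G\<^esub> \<and>
    (\<forall>y \<in> pverts (enhanced_power_graph G). y \<noteq> x \<longrightarrow> (x, y) \<in> parcs (enhanced_power_graph G))"

text \<open>Meaningful for finite \<open>G\<close> and prime \<open>p\<close>: the order is the exact power of \<open>p\<close> in \<open>|G|\<close>.\<close>

definition sylow_subgroup :: "nat \<Rightarrow> 'a set \<Rightarrow> ('a, 'b) monoid_scheme \<Rightarrow> bool" where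
  "sylow_subgroup p H G \<longleftrightarrow> subgroup H G \<and> card H = p ^ multiplicity p (order G)"

end

theory Submission
  imports Defs "HOL-Number_Theory.Cong"
begin

text \<open>
  A cyclic group has at most one subgroup of order \<open>p\<close>. If \<open>x\<close> is a cone vertex and \<open>p\<close> a prime
  dividing its order, the power \<open>u\<close> of \<open>x\<close> of order \<open>p\<close> lies in a common cyclic subgroup with
  every \<open>y\<close> satisfying \<open>y\<^sup>p = 1\<close>, so there are at most \<open>p\<close> such \<open>y\<close>. Since the \<open>p\<close>-th power map is
  a homomorphism, at most \<open>p\<^sup>i\<close> elements are killed by \<open>p\<^sup>i\<close>, and counting yields an element
  generating the Sylow \<open>p\<close>-subgroup. Conversely, an element \<open>x\<close> of order \<open>p\<close> of a cyclic Sylow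
  \<open>p\<close>-subgroup is a cone vertex: if \<open>p\<close> divides the order of \<open>y\<close> then \<open>x\<close> is a power of \<open>y\<close>, and
  otherwise \<open>x\<close> and \<open>y\<close> are both powers of \<open>x y\<close>.
\<close>

section \<open>Powers of an element and membership in subgroups\<close>

lemma (in group) pow_cong:
  assumes "x \<in> carrier G" "x [^] n = \<one>" "[i = j] (mod n)"
  shows "x [^] i = x [^] (j::nat)"
proof -
  have "x [^] k = x [^] (k mod n)" for k :: nat
  proof -
    have "x [^] k = x [^] (n * (k div n) + k mod n)" by simp
    also have "\<dots> = (x [^] n) [^] (k div n) \<otimes> x [^] (k mod n)"
      using assms(1) by (simp only: nat_pow_mult nat_pow_pow)
    finally show ?thesis using assms(1,2) by simp
  qed
  with assms(3) show ?thesis by (metis cong_def)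
qed

text \<open>This is the uniqueness of the subgroup of order \<open>p\<close> in the cyclic group of
  \<open>z\<close>: both powers lie in it, and any nontrivial element of it generates it.\<close>

lemma (in group) pow_of_prime_order_in_powers:
  fixes i j p :: nat
  assumes z: "z \<in> carrier G" and p: "Factorial_Ring.prime p"
    and u: "z [^] i \<noteq> \<one>" "(z [^] i) [^] p = \<one>" and v: "(z [^] j) [^] p = \<one>"
  shows "\<exists>k<p. z [^] j = (z [^] i) [^] k"
proof -
  let ?N = "ord z"
  have d: "?N dvd i * p" "?N dvd j * p" "\<not> ?N dvd i"
    using z u v by (simp_all add: nat_pow_pow pow_eq_id)
  \<comment> \<open>Otherwise \<open>?N\<close> is coprime to \<open>p\<close>, and
    \<open>?N dvd i * p\<close> would force \<open>?N dvd i\<close>.\<close>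
  have "p dvd ?N"
    using d(1,3) p by (metis coprime_commute coprime_dvd_mult_left_iff prime_imp_coprime)
  then obtain n where n: "?N = n * p" by (metis dvdE mult.commute)
  have p0: "p > 0" using p by (rule prime_gt_0_nat)
  obtain a where a: "i = n * a" using d(1) n p0 by auto
  obtain b where b: "j = n * b" using d(2) n p0 by auto
  \<comment> \<open>A generator of the subgroup of order \<open>p\<close>; the exponent
    \<open>a\<close> of \<open>z [^] i\<close> over \<open>s\<close> will be invertible modulo
    \<open>p\<close>.\<close>
  define s where "s = z [^] n"
  have s: "s \<in> carrier G" "s [^] p = \<one>"
    using z n by (simp_all add: s_def nat_pow_pow pow_eq_id)
  have ua: "z [^] i = s [^] a" and vb: "z [^] j = s [^] b"
    using z a b by (simp_all add: s_def nat_pow_pow)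
  have "\<not> p dvd a" using d(3) n a by auto
  then have "coprime a p" using p by (metis coprime_commute prime_imp_coprime)
  then obtain t where "[a * t = Suc 0] (mod p)" using cong_solve_coprime_nat by blast
  then have "[a * t * b = Suc 0 * b] (mod p)" by (rule cong_scalar_right)
  then have "s [^] (a * t * b) = s [^] b" using pow_cong[OF s] by simp
  then have "z [^] j = (z [^] i) [^] (t * b)"
    using s by (simp add: ua vb nat_pow_pow mult.assoc)
  \<comment> \<open>Reducing the exponent modulo \<open>p\<close> leaves only \<open>p\<close>
    candidates, which later bounds the number of solutions.\<close>
  also have "\<dots> = (z [^] i) [^] (t * b mod p)"
    using z u(2) by (intro pow_cong[of _ p]) (simp_all add: cong_def)
  finally show ?thesis using p0 by (metis mod_less_divisor)
qed

text \<open>By Bezout, \<open>x\<close> is a product of integer powers of \<open>x [^] m\<close> and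
  \<open>x [^] n\<close>.\<close>

lemma (in group) mem_subgroup_of_coprime_pow:
  fixes m n :: nat
  assumes H: "subgroup H G" and x: "x \<in> carrier G"
    and mn: "coprime m n" and "x [^] m \<in> H" "x [^] n \<in> H"
  shows "x \<in> H"
proof -
  interpret H: subgroup H G by fact
  have pw: "y [^] k \<in> H" if "y \<in> H" for y and k :: int
    using subgroup_int_pow_closed[OF H that] .
  obtain a b where ab: "a * int m + b * int n = 1"
    using mn bezout_int[of "int m" "int n"] by auto
  have "x = x [^] (int m * a + int n * b)"
    using ab x by (simp add: mult.commute)
  also have "\<dots> = (x [^] m) [^] a \<otimes> (x [^] n) [^] b"
    using x by (simp add: int_pow_mult int_pow_pow flip: int_pow_int)
  also have "\<dots> \<in> H" using assms pw by blast
  finally show ?thesis .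
qed

text \<open>The index is the order of the quotient \<open>G Mod H\<close>, so this power of every
  coset is trivial there.\<close>

lemma (in comm_group) pow_index_mem_subgroup:
  assumes H: "subgroup H G" and x: "x \<in> carrier G"
  shows "x [^] card (rcosets H) \<in> H"
proof -
  interpret N: normal H G using H normal_iff_subgroup by simp
  interpret Q: group "G Mod H" by (rule N.factorgroup_is_group)
  interpret h: group_hom G "G Mod H" "(#>) H"
    using N.r_coset_hom_Mod by unfold_locales
  have "H #> (x [^] card (rcosets H)) = (H #> x) [^]\<^bsub>G Mod H\<^esub> order (G Mod H)"
    using x h.hom_nat_pow by (simp add: FactGroup_def order_def)
  also have "\<dots> = \<one>\<^bsub>G Mod H\<^esub>"
    using x by (intro Q.pow_order_eq_1) simp
  finally have "H #> (x [^] card (rcosets H)) = H" by (simp add: FactGroup_def)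
  then show ?thesis using x rcos_self[OF _ H] by (metis nat_pow_closed)
qed

section \<open>Torsion counts and cyclic subgroups of prime power order\<close>

text \<open>The \<open>p\<close>-th power map sends \<open>?K (Suc i)\<close> into
  \<open>?K i\<close>, and each of its fibres is empty or a coset of its kernel, hence has at most
  \<open>p\<close> elements.\<close>

lemma (in comm_group) card_power_torsion_le:
  assumes fin: "finite (carrier G)" and p: "card {x \<in> carrier G. x [^] p = \<one>} \<le> p"
  shows "card {x \<in> carrier G. x [^] (p ^ i) = \<one>} \<le> p ^ i" (is "card (?K i) \<le> _")
proof (induction i)
  case 0
  have "?K 0 = {\<one>}" by auto
  then show ?case by simp
next
  case (Suc i)
  let ?F = "\<lambda>y. {x \<in> carrier G. x [^] p = y}"
  have fibre: "card (?F y) \<le> p" for y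
  proof (cases "?F y = {}")
    case True
    show ?thesis unfolding True by simp
  next
    case False
    then obtain w where w: "w \<in> carrier G" "w [^] p = y" by auto
    have "card (?F y) \<le> card {x \<in> carrier G. x [^] p = \<one>}"
    proof (rule card_inj_on_le)
      show "inj_on (\<lambda>x. x \<otimes> inv w) (?F y)"
        using w by (auto intro!: inj_onI)
      show "(\<lambda>x. x \<otimes> inv w) ` ?F y \<subseteq> {x \<in> carrier G. x [^] p = \<one>}"
        using w by (auto simp: nat_pow_distrib nat_pow_inv r_inv)
    qed (use fin in auto)
    with p show ?thesis by linarith
  qed
  have "?K (Suc i) \<subseteq> (\<Union>y \<in> ?K i. ?F y)"
    by (auto simp: nat_pow_pow)
  then have "card (?K (Suc i)) \<le> card (\<Union>y \<in> ?K i. ?F y)"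
    using fin by (intro card_mono) auto
  also have "\<dots> \<le> (\<Sum>y \<in> ?K i. card (?F y))"
    using fin by (intro card_UN_le) auto
  also have "\<dots> \<le> card (?K i) * p"
    using sum_bounded_above[of "?K i" "\<lambda>y. card (?F y)" p] fibre by simp
  also have "\<dots> \<le> p ^ i * p" using Suc by (rule mult_le_mono1)
  finally show ?case by (simp add: mult.commute)
qed

text \<open>For \<open>k = Suc i\<close>, the elements killed by \<open>p ^ i\<close> are too few to
  fill \<open>H\<close>; any other element of \<open>H\<close> has order \<open>p ^ k\<close> and
  generates \<open>H\<close>.\<close>

lemma (in comm_group) cyclic_p_subgroup:
  assumes fin: "finite (carrier G)" and p: "Factorial_Ring.prime p"
    and tors: "card {x \<in> carrier G. x [^] p = \<one>} \<le> p"
    and H: "subgroup H G" and card_H: "card H = p ^ k"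
  shows "cyclic_group (G\<lparr>carrier := H\<rparr>)"
proof (cases k)
  case 0
  interpret K: group "G\<lparr>carrier := H\<rparr>" by (rule subgroup_imp_group[OF H])
  have "order (G\<lparr>carrier := H\<rparr>) = 1" using card_H 0 by (simp add: order_def)
  then have "trivial_group (G\<lparr>carrier := H\<rparr>)"
    using K.order_one_triv_iff K.is_group by (simp add: trivial_group_def)
  then show ?thesis by (rule trivial_imp_cyclic_group)
next
  case (Suc i)
  interpret K: group "G\<lparr>carrier := H\<rparr>" by (rule subgroup_imp_group[OF H])
  have HG: "H \<subseteq> carrier G" using H by (rule subgroup.subset)
  have finH: "finite H" using HG fin by (rule finite_subset)
  have "p ^ i < card H" using card_H Suc prime_gt_1_nat[OF p] by simp
  then have "card {x \<in> carrier G. x [^] (p ^ i) = \<one>} < card H"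
    using card_power_torsion_le[OF fin tors, of i] by linarith
  then obtain g where g: "g \<in> H" "g [^] (p ^ i) \<noteq> \<one>"
    using card_mono[of "{x \<in> carrier G. x [^] (p ^ i) = \<one>}" H] fin HG by fastforce
  have gK: "g \<in> carrier (G\<lparr>carrier := H\<rparr>)" using g by simp
  have "K.ord g dvd p ^ Suc i"
    using K.ord_dvd_group_order[OF gK] card_H Suc by (simp add: order_def)
  moreover have "\<not> K.ord g dvd p ^ i"
    using K.pow_eq_id[OF gK] g(2) by (simp add: nat_pow_consistent[symmetric])
  ultimately have "K.ord g = p ^ Suc i"
    unfolding divides_primepow_nat[OF p] by (auto simp: le_Suc_eq)
  then have "card (generate (G\<lparr>carrier := H\<rparr>) {g}) = card H"
    using K.generate_pow_card[OF gK] card_H Suc by simp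
  moreover have "generate (G\<lparr>carrier := H\<rparr>) {g} \<subseteq> H"
    using K.generate_incl[of "{g}"] gK by simp
  ultimately have "generate (G\<lparr>carrier := H\<rparr>) {g} = H"
    using finH by (simp add: card_subset_eq)
  then have "subgroup_generated (G\<lparr>carrier := H\<rparr>) {g} = G\<lparr>carrier := H\<rparr>"
    using g by (simp add: subgroup_generated_def)
  then show ?thesis using gK by (auto simp: cyclic_group_def)
qed

section \<open>Cone vertices and Sylow subgroups\<close>

lemma (in group) cone_vertex_iff:
  "cone_vertex G x \<longleftrightarrow> x \<in> carrier G \<and> x \<noteq> \<one> \<and>
    (\<forall>y \<in> carrier G. \<exists>z \<in> carrier G. \<exists>(m::nat) (n::nat). x = z [^] m \<and> y = z [^] n)"
proof -
  have "\<exists>z \<in> carrier G. \<exists>(m::nat) (n::nat). x = z [^] m \<and> x = z [^] n" if "x \<in> carrier G"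
    using that by (intro bexI[of _ x] exI[of _ 1]) simp_all
  then show ?thesis
    unfolding cone_vertex_def enhanced_power_graph_def pair_pre_digraph.simps mem_Collect_eq case_prod_conv
    by metis
qed

lemma (in comm_group) cone_vertex_imp_card_prime_torsion_le:
  assumes fin: "finite (carrier G)" and cone: "cone_vertex G x"
  shows "\<exists>p. Factorial_Ring.prime p \<and> p dvd order G \<and> card {y \<in> carrier G. y [^] p = \<one>} \<le> p"
proof -
  have x: "x \<in> carrier G" "x \<noteq> \<one>"
    and adj: "\<And>y. y \<in> carrier G \<Longrightarrow> \<exists>z \<in> carrier G. \<exists>(m::nat) (n::nat). x = z [^] m \<and> y = z [^] n"
    using cone unfolding cone_vertex_iff by blast+
  have "ord x \<noteq> 1" using x ord_eq_1 by blast
  then obtain p where p: "Factorial_Ring.prime p" "p dvd ord x"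
    by (metis prime_factor_nat)
  \<comment> \<open>Chosen so that \<open>x [^] d\<close> has order exactly
    \<open>p\<close>.\<close>
  define d where "d = ord x div p"
  have d: "ord x = d * p" using p by (simp add: d_def)
  have "ord x > 0" using x fin ord_ge_1 by fastforce
  then have "\<not> ord x dvd d" using p d prime_gt_1_nat[OF p(1)]
    by (auto dest!: dvd_imp_le)
  then have u: "x [^] d \<noteq> \<one>" "(x [^] d) [^] p = \<one>"
    using x d by (simp_all add: pow_eq_id nat_pow_pow)
  have "{y \<in> carrier G. y [^] p = \<one>} \<subseteq> (\<lambda>k. (x [^] d) [^] k) ` {..<p}"
  proof safe
    fix y assume y: "y \<in> carrier G" "y [^] p = \<one>"
    then obtain z and m n :: nat where z: "z \<in> carrier G" "x = z [^] m" "y = z [^] n"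
      using adj by blast
    then have "x [^] d = z [^] (m * d)" by (simp add: nat_pow_pow)
    then show "y \<in> (\<lambda>k. (x [^] d) [^] k) ` {..<p}"
      using pow_of_prime_order_in_powers[OF z(1) p(1), of "m * d" n] u y z(3) by auto
  qed
  then have "card {y \<in> carrier G. y [^] p = \<one>} \<le> p"
    using surj_card_le[of "{..<p}"] by simp
  moreover have "p dvd order G" using p(2) ord_dvd_group_order[OF x(1)] by (rule dvd_trans)
  ultimately show ?thesis using p(1) by blast
qed

text \<open>The hypothesis \<open>tors\<close> says that \<open>x\<close> lies in every subgroup of
  order \<open>p\<close>.\<close>

lemma (in comm_group) cone_vertex_if_torsion_powers:
  fixes p :: nat
  assumes fin: "finite (carrier G)" and p: "Factorial_Ring.prime p"
    and x: "x \<in> carrier G" "x \<noteq> \<one>" "x [^] p = \<one>"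
    and tors: "\<And>y. \<lbrakk>y \<in> carrier G; y \<noteq> \<one>; y [^] p = \<one>\<rbrakk> \<Longrightarrow> \<exists>k::nat. x = y [^] k"
  shows "cone_vertex G x"
  unfolding cone_vertex_iff
proof (intro conjI ballI)
  fix y assume y: "y \<in> carrier G"
  show "\<exists>z \<in> carrier G. \<exists>(m::nat) (n::nat). x = z [^] m \<and> y = z [^] n"
  proof (cases "p dvd ord y")
    case True
    then obtain d where d: "ord y = d * p" by (metis dvdE mult.commute)
    have "ord y > 0" using y fin ord_ge_1 by fastforce
    then have "\<not> ord y dvd d" using d prime_gt_1_nat[OF p] by (auto dest!: dvd_imp_le)
    then have "y [^] d \<noteq> \<one>" "(y [^] d) [^] p = \<one>"
      using y d by (simp_all add: pow_eq_id nat_pow_pow)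
    then obtain k :: nat where "x = (y [^] d) [^] k" using tors y by blast
    then have "x = y [^] (d * k)" "y = y [^] (1::nat)" using y by (simp_all add: nat_pow_pow)
    then show ?thesis using y by blast
  next
    case False
    then have cop: "coprime (ord y) p" using p by (metis coprime_commute prime_imp_coprime)
    obtain s where s: "[ord y * s = Suc 0] (mod p)" using cong_solve_coprime_nat[OF cop] by blast
    obtain t where t: "[p * t = Suc 0] (mod ord y)"
      using cong_solve_coprime_nat[of p "ord y"] cop by (auto simp: coprime_commute)
    \<comment> \<open>The exponent kills \<open>y\<close> and is 1 modulo \<open>p\<close>, so it
      extracts \<open>x\<close> from the product; \<open>p * t\<close> extracts \<open>y\<close> in
      the same way.\<close>
    have "(x \<otimes> y) [^] (ord y * s) = x [^] (ord y * s)"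
      using x y by (simp add: nat_pow_distrib flip: nat_pow_pow)
    also have "\<dots> = x" using pow_cong[OF x(1,3) s] x by simp
    finally have "x = (x \<otimes> y) [^] (ord y * s)" ..
    moreover have "(x \<otimes> y) [^] (p * t) = y [^] (p * t)"
      using x y by (simp add: nat_pow_distrib flip: nat_pow_pow)
    then have "y = (x \<otimes> y) [^] (p * t)" using pow_cong[OF y _ t] y by simp
    ultimately show ?thesis using x y m_closed by blast
  qed
qed (use x in auto)

lemma (in comm_group) cyclic_sylow_imp_cone_vertex:
  assumes fin: "finite (carrier G)" and p: "Factorial_Ring.prime p" "p dvd order G"
    and syl: "sylow_subgroup p H G" and cyc: "cyclic_group (G\<lparr>carrier := H\<rparr>)"
  shows "\<exists>x. cone_vertex G x"
proof -
  let ?k = "multiplicity p (order G)"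
  have H: "subgroup H G" and card_H: "card H = p ^ ?k"
    using syl by (auto simp: sylow_subgroup_def)
  interpret K: group "G\<lparr>carrier := H\<rparr>" by (rule subgroup_imp_group[OF H])
  have HG: "H \<subseteq> carrier G" using H by (rule subgroup.subset)
  have ord0: "order G > 0" using fin by (simp add: order_gt_0_iff_finite)
  then obtain i where i: "?k = Suc i"
    using p prime_multiplicity_gt_zero_iff[of p "order G"] gr0_conv_Suc by auto
  have index: "card (rcosets H) * p ^ ?k = order G" using lagrange[OF H] card_H by simp
  \<comment> \<open>A factor \<open>p\<close> in the index would give a power of \<open>p\<close>
    dividing \<open>order G\<close> beyond the multiplicity.\<close>
  have cop: "coprime (card (rcosets H)) p"
  proof (rule ccontr)
    assume "\<not> ?thesis"
    then have "p dvd card (rcosets H)" using p by (metis coprime_commute prime_imp_coprime)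
    then have "p ^ Suc ?k dvd order G"
      by (metis index mult_dvd_mono dvd_refl power_Suc)
    then have "Suc ?k \<le> ?k"
      using ord0 p(1) by (intro multiplicity_geI) auto
    then show False by simp
  qed
  \<comment> \<open>Both the \<open>p\<close>-th power of \<open>y\<close> and its power by the
    index lie in \<open>H\<close>, and these exponents are coprime.\<close>
  have mem: "y \<in> H" if "y \<in> carrier G" "y [^] p = \<one>" for y
    using mem_subgroup_of_coprime_pow[OF H that(1) cop]
      pow_index_mem_subgroup[OF H that(1)] that(2) subgroup.one_closed[OF H] by simp
  obtain g where g: "g \<in> H" and gen: "subgroup_generated (G\<lparr>carrier := H\<rparr>) {g} = G\<lparr>carrier := H\<rparr>"
    using cyc by (auto simp: cyclic_group_def)
  have gK: "g \<in> carrier (G\<lparr>carrier := H\<rparr>)" and gG: "g \<in> carrier G" using g HG by auto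
  have genK: "generate (G\<lparr>carrier := H\<rparr>) {g} = H"
    using arg_cong[OF gen, of carrier] g by (simp add: carrier_subgroup_generated)
  have ordg: "K.ord g = p ^ ?k" using K.generate_pow_card[OF gK] genK card_H by simp
  have pow: "\<exists>n::nat. y = g [^] n" if "y \<in> H" for y
    using that genK K.generate_pow_nat[OF gK] ordg p(1)
    by (auto simp: nat_pow_consistent[symmetric] prime_gt_0_nat)
  have pow1: "g [^] n = \<one> \<longleftrightarrow> p ^ ?k dvd n" for n :: nat
    using K.pow_eq_id[OF gK, of n] ordg by (simp add: nat_pow_consistent[symmetric])
  \<comment> \<open>Since \<open>g\<close> has order \<open>p ^ Suc i\<close>, this power has order
    \<open>p\<close>.\<close>
  define x where "x = g [^] (p ^ i)"
  have x: "x \<in> carrier G" "x \<noteq> \<one>" "x [^] p = \<one>"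
    using gG i prime_gt_1_nat[OF p(1)]
    by (auto simp: x_def nat_pow_pow pow1 mult.commute dest!: dvd_imp_le)
  have "cone_vertex G x"
  proof (rule cone_vertex_if_torsion_powers[OF fin p(1) x])
    fix y assume y: "y \<in> carrier G" "y \<noteq> \<one>" "y [^] p = \<one>"
    then obtain n :: nat where n: "y = g [^] n" using mem pow by blast
    show "\<exists>k::nat. x = y [^] k"
      using pow_of_prime_order_in_powers[OF gG p(1), of n "p ^ i"] y x n
      by (auto simp: x_def)
  qed
  then show ?thesis ..
qed

theorem theorem3p2:
  fixes G :: "('a, 'b) monoid_scheme"
  assumes "comm_group G"
    and "finite (carrier G)"
  shows "(\<exists>x. cone_vertex G x) \<longleftrightarrow>
    (\<exists>p :: nat. Factorial_Ring.prime p \<and> p dvd order G \<and>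
      (\<exists>H. sylow_subgroup p H G \<and> cyclic_group (G\<lparr>carrier := H\<rparr>)))"
proof -
  interpret comm_group G by fact
  have "\<exists>p. Factorial_Ring.prime p \<and> p dvd order G \<and>
      (\<exists>H. sylow_subgroup p H G \<and> cyclic_group (G\<lparr>carrier := H\<rparr>))" if cone: "cone_vertex G x" for x
  proof -
    obtain p where p: "Factorial_Ring.prime p" "p dvd order G"
      and tors: "card {y \<in> carrier G. y [^]\<^bsub>G\<^esub> p = \<one>\<^bsub>G\<^esub>} \<le> p"
      using cone_vertex_imp_card_prime_torsion_le[OF assms(2) cone] by blast
    obtain m where "order G = p ^ multiplicity p (order G) * m"
      using multiplicity_dvd by blast
    \<comment> \<open>Sylow's theorem is applied with the full multiplicity as exponent, so
      \<open>H\<close> is a Sylow subgroup.\<close>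
    then obtain H where H: "subgroup H G" "card H = p ^ multiplicity p (order G)"
      using sylow_thm[OF p(1) is_group _ assms(2)] by blast
    then show ?thesis
      using p cyclic_p_subgroup[OF assms(2) p(1) tors H] by (auto simp: sylow_subgroup_def)
  qed
  then show ?thesis using cyclic_sylow_imp_cone_vertex[OF assms(2)] by blast
qed

end
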